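(* Let $d,p\ge1$ be integers, $D=\binom{d+p-1}{p}$, and let $\mathcal V\subset\mathbb R^d$ be a projective variety whose $p$-th order tensorized subspace $\mathcal S\subset\mathbb R^D$ is $R$-dimensional. Let $\upsilon_1,\dots,\upsilon_n\in\{0,1\}^D$ be $n$ distinct tensorized observation patterns, and for $i=1,\dots,n$ put $M_i:=|\upsilon_i|$ and $R_i':=\dim\mathcal S_{\upsilon_i}$. If $\mathcal S$ is uniquely identifiable from its canonical projections onto $\upsilon_1,\dots,\upsilon_n$, then $$\sum_{i=1}^n (M_i-R_i')\ \ge\ D-R.$$
   Context: Tensorization: for $x\in\mathbb R^d$, $x^{\otimes p}\in\mathbb R^D$ with $D=\binom{d+p-1}{p}$ denotes the vector whose coordinates are indexed by tuples $1\le k_1\le\cdots\le k_p\le d$, the coordinate $(k_1,\dots,k_p)$ being $x_{k_1}\cdots x_{k_p}$. A (real) projective variety $\mathcal V\subset\mathbb R^d$ is the common zero set in $\mathbb R^d$ of finitely many homogeneous polynomials (possibly of different degrees). Its $p$-th order tensorized subspace is $\mathcal S=\operatorname{span}\{x^{\otimes p}:x\in\mathcal V\}\subset\mathbb R^D$. A tensorized observation pattern is a vector $\omega^{\otimes p}\in\{0,1\}^D$ with $\omega\in\{0,1\}^d$; $|\upsilon|$ denotes the number of ones of a binary vector $\upsilon$. For $\upsilon\in\{0,1\}^D$, $\mathcal S_\upsilon=\{y_\upsilon:y\in\mathcal S\}\subset\mathbb R^{|\upsilon|}$, where $y_\upsilon$ is the restriction of $y$ to the coordinates where $\upsilon$ equals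 one, is the canonical projection of $\mathcal S$ onto $\upsilon$. A subspace $\mathcal S\subset\mathbb R^D$ is uniquely identifiable from its canonical projections onto patterns $\upsilon_1,\dots,\upsilon_n$ if the only subspace $\mathcal S'\subset\mathbb R^D$ with $\mathcal S'_{\upsilon_i}=\mathcal S_{\upsilon_i}$ for all $i$ is $\mathcal S'=\mathcal S$. *)

theory Defs
  imports "HOL-Analysis.Analysis" "HOL-Analysis.Finite_Function_Topology"
begin

text \<open>
  The space of real vectors with coordinates indexed by a finite set \<open>I\<close> is modelled inside the
  real vector space of finitely supported functions, as the functions vanishing outside \<open>I\<close>.
  Hence the notions \<^const>\<open>subspace\<close>, \<^const>\<open>span\<close> and \<^const>\<open>dim\<close> apply directly, while the
  index sets may depend on the numbers \<open>d\<close> and \<open>p\<close>.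
\<close>

type_synonym 'i rvec = "'i \<Rightarrow>\<^sub>0 real"

definition coord_space :: "'i set \<Rightarrow> 'i rvec set"
  where "coord_space I = {y. Poly_Mapping.keys y \<subseteq> I}"

abbreviation real_space :: "nat \<Rightarrow> nat rvec set"
  where "real_space d \<equiv> coord_space {1..d}"


subsection \<open>Tensorization\<close>

definition tensor_index :: "nat \<Rightarrow> nat \<Rightarrow> nat list set"
  where "tensor_index d p = {ks. length ks = p \<and> sorted ks \<and> set ks \<subseteq> {1..d}}"

abbreviation tensor_space :: "nat \<Rightarrow> nat \<Rightarrow> nat list rvec set"
  where "tensor_space d p \<equiv> coord_space (tensor_index d p)"

definition tensor_power :: "nat \<Rightarrow> nat \<Rightarrow> nat rvec \<Rightarrow> nat list rvec"
  where "tensor_power d p x =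
    (\<Sum>ks\<in>tensor_index d p. Poly_Mapping.single ks (\<Prod>k\<leftarrow>ks. Poly_Mapping.lookup x k))"

lemma finite_tensor_index: "finite (tensor_index d p)"
proof (rule finite_subset)
  show "tensor_index d p \<subseteq> {ks. set ks \<subseteq> {1..d} \<and> length ks = p}"
    by (auto simp: tensor_index_def)
  show "finite {ks. set ks \<subseteq> {1..d} \<and> length ks = p}"
    by (rule finite_lists_length_eq) simp
qed

lemma lookup_tensor_power:
  "Poly_Mapping.lookup (tensor_power d p x) ks =
    (if ks \<in> tensor_index d p then \<Prod>k\<leftarrow>ks. Poly_Mapping.lookup x k else 0)"
  by (simp add: tensor_power_def lookup_sum lookup_single when_def finite_tensor_index)


subsection \<open>Projective varieties\<close>

text \<open>
  A polynomial maps monomials to coefficients, and a monomial maps variables to exponents.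
\<close>

type_synonym mpoly = "(nat \<Rightarrow>\<^sub>0 nat) \<Rightarrow>\<^sub>0 real"

definition mpoly_eval :: "mpoly \<Rightarrow> nat rvec \<Rightarrow> real"
  where "mpoly_eval q x =
    (\<Sum>m\<in>Poly_Mapping.keys q. Poly_Mapping.lookup q m *
      (\<Prod>k\<in>Poly_Mapping.keys m. Poly_Mapping.lookup x k ^ Poly_Mapping.lookup m k))"

definition polynomial_in :: "nat \<Rightarrow> mpoly \<Rightarrow> bool"
  where "polynomial_in d q \<longleftrightarrow> (\<forall>m\<in>Poly_Mapping.keys q. Poly_Mapping.keys m \<subseteq> {1..d})"

definition homogeneous :: "nat \<Rightarrow> mpoly \<Rightarrow> bool"
  where "homogeneous e q \<longleftrightarrow>
    (\<forall>m\<in>Poly_Mapping.keys q. (\<Sum>k\<in>Poly_Mapping.keys m. Poly_Mapping.lookup m k) = e)"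

definition projective_variety :: "nat \<Rightarrow> nat rvec set \<Rightarrow> bool"
  where "projective_variety d V \<longleftrightarrow>
    (\<exists>Q. finite Q \<and> (\<forall>q\<in>Q. polynomial_in d q \<and> (\<exists>e. homogeneous e q)) \<and>
         V = {x \<in> real_space d. \<forall>q\<in>Q. mpoly_eval q x = 0})"

definition tensorized_subspace :: "nat \<Rightarrow> nat \<Rightarrow> nat rvec set \<Rightarrow> nat list rvec set"
  where "tensorized_subspace d p V = span (tensor_power d p ` V)"


subsection \<open>Observation patterns, projections and identifiability\<close>

definition binary_vectors :: "'i set \<Rightarrow> 'i rvec set"
  where "binary_vectors I = {w \<in> coord_space I. \<forall>k\<in>I. Poly_Mapping.lookup w k \<in> {0, 1}}"

definition ones :: "'i rvec \<Rightarrow> 'i set"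
  where "ones v = {k. Poly_Mapping.lookup v k = 1}"

definition tensorized_patterns :: "nat \<Rightarrow> nat \<Rightarrow> nat list rvec set"
  where "tensorized_patterns d p = tensor_power d p ` binary_vectors {1..d}"

text \<open>
  The restriction of \<open>y\<close> to the coordinates in \<open>ones v\<close> is an element of \<open>coord_space (ones v)\<close>,
  which plays the role of the space of real vectors with \<open>card (ones v)\<close> coordinates.
\<close>

definition restriction :: "'i rvec \<Rightarrow> 'i rvec \<Rightarrow> 'i rvec"
  where "restriction v y = Poly_Mapping.mapp (\<lambda>k c. if k \<in> ones v then c else 0) y"

definition canonical_projection :: "'i rvec \<Rightarrow> 'i rvec set \<Rightarrow> 'i rvec set"
  where "canonical_projection v S = restriction v ` S"

lemma lookup_restriction:
  "Poly_Mapping.lookup (restriction v y) k = (if k \<in> ones v then Poly_Mapping.lookup y k else 0)"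
  by (simp add: restriction_def lookup_mapp when_def in_keys_iff)

definition uniquely_identifiable ::
    "'i set \<Rightarrow> 'i rvec set \<Rightarrow> nat \<Rightarrow> (nat \<Rightarrow> 'i rvec) \<Rightarrow> bool"
  where "uniquely_identifiable I S n v \<longleftrightarrow>
    (\<forall>S'. subspace S' \<and> S' \<subseteq> coord_space I \<and>
          (\<forall>i\<in>{1..n}. canonical_projection (v i) S' = canonical_projection (v i) S) \<longrightarrow>
          S' = S)"

end

theory Submission
  imports Defs
begin

text \<open>
  The subspace \<open>T\<close> of all vectors whose projections onto the patterns lie in the projections of \<open>S\<close>
  contains \<open>S\<close> and has the same projections as \<open>S\<close>, so unique identifiability forces \<open>T = S\<close>. As
  \<open>T\<close> is cut out by \<open>M\<^sub>i - R'\<^sub>i\<close> linear equations for every pattern, its codimension is at most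
  the sum of these numbers.
\<close>

section \<open>Linear functionals and codimension\<close>

text \<open>A single vector of \<open>X\<close> on which \<open>g\<close> does not vanish spans
  \<open>X\<close> together with a basis of the kernel. The finite spanning set \<open>F\<close>
  keeps that basis finite; an infinite basis would have \<open>card\<close> 0.\<close>

lemma dim_le_dim_kernel_Suc:
  fixes g :: "'a::real_vector \<Rightarrow> real"
  assumes g: "linear g" and X: "subspace X" and F: "finite F" "X \<subseteq> span F"
  shows "dim X \<le> Suc (dim {x \<in> X. g x = 0})"
proof (cases "\<forall>x\<in>X. g x = 0")
  case True
  then have "{x \<in> X. g x = 0} = X" by auto
  then show ?thesis by simp
next
  case False
  then obtain z where z: "z \<in> X" "g z \<noteq> 0" by auto
  let ?K = "{x \<in> X. g x = 0}"
  obtain E where E: "E \<subseteq> ?K" "independent E" "?K \<subseteq> span E" "card E = dim ?K"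
    using real_vector.basis_exists by blast
  have finE: "finite E"
    using real_vector.independent_span_bound[OF F(1) E(2)] E(1) F(2) by auto
  have "X \<subseteq> span (insert z E)"
  proof
    fix x assume x: "x \<in> X"
    \<comment> \<open>The multiple of \<open>z\<close> is chosen to cancel the value of
      \<open>g\<close> at \<open>x\<close>.\<close>
    have "x - (g x / g z) *\<^sub>R z \<in> ?K"
      using x z X by (simp add: linear_diff[OF g] linear_scale[OF g] subspace_diff subspace_scale)
    then show "x \<in> span (insert z E)"
      using E(3) by (meson span_breakdown_eq subsetD)
  qed
  then have "dim X \<le> card (insert z E)"
    by (rule real_vector.dim_le_card) (simp add: finE)
  also have "\<dots> \<le> Suc (dim ?K)"
    using E(4) by (simp add: card_insert_if finE)
  finally show ?thesis .
qed

text \<open>Induction on the equations, each costing at most one dimension. They form an indexed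
  family, so functionals that coincide are counted once per index.\<close>

lemma dim_le_dim_common_kernel:
  fixes g :: "'j \<Rightarrow> 'a::real_vector \<Rightarrow> real"
  assumes "finite J" and "\<And>j. j \<in> J \<Longrightarrow> linear (g j)"
    and X: "subspace X" and F: "finite F" "X \<subseteq> span F"
  shows "dim X \<le> dim {x \<in> X. \<forall>j\<in>J. g j x = 0} + card J"
  using assms(1,2)
proof (induction J rule: finite_induct)
  case empty
  then show ?case by simp
next
  case (insert k J)
  let ?X = "{x \<in> X. \<forall>j\<in>J. g j x = 0}"
  have lin: "linear (g j)" if "j \<in> insert k J" for j
    using insert.prems that .
  have "subspace ?X"
    using X lin by (auto simp: subspace_def linear_0 linear_add linear_scale)
  then have "dim ?X \<le> Suc (dim {x \<in> ?X. g k x = 0})"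
    using lin F by (intro dim_le_dim_kernel_Suc[where F = F]) auto
  moreover have "{x \<in> ?X. g k x = 0} = {x \<in> X. \<forall>j\<in>insert k J. g j x = 0}"
    by auto
  ultimately show ?case
    using insert by simp
qed

text \<open>Extend a basis \<open>B\<close> of \<open>W\<close> to a basis \<open>C\<close> of
  \<open>Y\<close>: the coordinates belonging to \<open>C - B\<close> are the required
  functionals.\<close>

lemma subspace_eq_common_kernel:
  fixes W Y :: "'a::real_vector set"
  assumes W: "subspace W" and Y: "subspace Y" and WY: "W \<subseteq> Y"
    and F: "finite F" "Y \<subseteq> span F"
  obtains J :: "('a \<Rightarrow> real) set"
  where "finite J" "card J + dim W = dim Y" "\<forall>g\<in>J. linear g"
    "W = {y \<in> Y. \<forall>g\<in>J. g y = 0}"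
proof -
  obtain B where B: "B \<subseteq> W" "independent B" "W \<subseteq> span B" "card B = dim W"
    using real_vector.basis_exists by blast
  obtain C where C: "B \<subseteq> C" "C \<subseteq> Y" "independent C" "Y \<subseteq> span C"
    using real_vector.maximal_independent_subset_extend[of B Y] B WY by blast
  \<comment> \<open>The functionals must be linear on the whole type, whereas
    \<open>representation C\<close> is 0 by default outside \<open>span C\<close>. Hence coordinates
    are taken with respect to a basis \<open>E\<close> of the full space.\<close>
  define E where "E = extend_basis C"
  have E: "C \<subseteq> E" "independent E" "span E = UNIV"
    using C(3) by (auto simp: E_def real_vector.extend_basis_superset
        real_vector.independent_extend_basis real_vector.span_extend_basis)
  have finC: "finite C"
    using real_vector.independent_span_bound[OF F(1) C(3)] C(2) F(2) by auto
  have cardC: "card C = dim Y"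
    using C real_vector.basis_card_eq_dim by blast
  have W_eq: "W = span B" and Y_eq: "Y = span C"
    using span_subspace[OF B(1,3) W] span_subspace[OF C(2,4) Y] by simp_all
  let ?g = "\<lambda>c y. representation E y c"
  \<comment> \<open>Distinct basis vectors give distinct functionals, told apart by their values at
    \<open>c\<close>; so the set of functionals has as many elements as
    \<open>C - B\<close>.\<close>
  have inj: "inj_on ?g (C - B)"
  proof (rule inj_onI)
    fix c c' assume c: "c \<in> C - B" "c' \<in> C - B" and eq: "?g c = ?g c'"
    have "?g c c = 1"
      using c E by (subst real_vector.representation_basis) auto
    moreover have "?g c' c = (if c' = c then 1 else 0)"
      using c E by (subst real_vector.representation_basis) auto
    ultimately show "c = c'"
      using eq by (metis zero_neq_one)
  qed
  show thesis
  proof (rule that[of "?g ` (C - B)"])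
    show "finite (?g ` (C - B))"
      using finC by simp
    show "card (?g ` (C - B)) + dim W = dim Y"
      using finC C(1) by (simp add: card_image[OF inj] card_Diff_subset finite_subset card_mono
          flip: B(4) cardC)
    show "\<forall>g\<in>?g ` (C - B). linear g"
      using E
      by (auto intro!: linearI simp: real_vector.representation_add real_vector.representation_scale)
    show "W = {y \<in> Y. \<forall>g\<in>?g ` (C - B). g y = 0}"
    proof safe
      fix y assume y: "y \<in> W"
      then show "y \<in> Y" using WY by auto
      fix c assume c: "c \<in> C" "c \<notin> B"
      have "representation E y = representation B y"
        using y E C(1) W_eq by (intro real_vector.representation_extend) auto
      then show "representation E y c = 0"
        using c real_vector.representation_ne_zero by metis
    next
      fix y assume y: "y \<in> Y" and 0: "\<forall>g\<in>?g ` (C - B). g y = 0"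
      have "representation E y = representation C y"
        using y E Y_eq by (intro real_vector.representation_extend) auto
      \<comment> \<open>All coordinates of \<open>y\<close> along \<open>C - B\<close> vanish, so
        its expansion in \<open>C\<close> involves \<open>B\<close> alone.\<close>
      then have sub: "b \<in> B" if "representation C y b \<noteq> 0" for b
        using that 0 real_vector.representation_ne_zero[of C y b] by auto
      have "(\<Sum>b | representation C y b \<noteq> 0. representation C y b *\<^sub>R b) = y"
        using y Y_eq C(3) by (intro real_vector.sum_nonzero_representation_eq) auto
      moreover have "(\<Sum>b | representation C y b \<noteq> 0. representation C y b *\<^sub>R b) \<in> span B"
        using sub by (intro span_sum span_scale span_base) auto
      ultimately show "y \<in> W"
        using W_eq by simp
    qed
  qed
qed

section \<open>Coordinate spaces over an index set\<close>

lemma lookup_scaleR [simp]: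
  "Poly_Mapping.lookup (r *\<^sub>R x) k = r *\<^sub>R Poly_Mapping.lookup x k"
  for x :: "'i \<Rightarrow>\<^sub>0 'a::real_vector"
proof -
  have "finite {i. r *\<^sub>R Poly_Mapping.lookup x i \<noteq> 0}"
    by (rule finite_subset[OF _ finite_keys[of x]]) (auto simp: in_keys_iff)
  then show ?thesis
    by (simp add: scaleR_poly_mapping_def)
qed

lemma coord_space_iff: "y \<in> coord_space I \<longleftrightarrow> (\<forall>k. k \<notin> I \<longrightarrow> Poly_Mapping.lookup y k = 0)"
  by (auto simp: coord_space_def in_keys_iff)

lemma subspace_coord_space: "subspace (coord_space I)"
  by (auto simp: subspace_def coord_space_iff lookup_add)

lemma linear_restriction: "linear (restriction v)"
  by (auto intro!: linearI poly_mapping_eqI simp: lookup_restriction lookup_add)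

lemma coord_space_basis:
  assumes "finite I"
  shows "coord_space I = span ((\<lambda>k. Poly_Mapping.single k (1::real)) ` I)" (is "_ = span ?B")
    and "independent ((\<lambda>k. Poly_Mapping.single k (1::real)) ` I)"
    and "dim (coord_space I) = card I"
proof -
  have inj: "inj_on (\<lambda>k. Poly_Mapping.single k (1::real)) I"
    by (auto intro!: inj_onI dest: arg_cong[where f = Poly_Mapping.keys])
  \<comment> \<open>Reading off coefficients of a combination of unit vectors serves both spanning
    and independence.\<close>
  have lookup: "Poly_Mapping.lookup (\<Sum>k\<in>I. u k *\<^sub>R Poly_Mapping.single k 1) j
      = (if j \<in> I then u j else 0)" for u :: "_ \<Rightarrow> real" and j
    using assms by (simp add: lookup_sum lookup_single when_def if_distrib[of "\<lambda>t. _ * t"] cong: if_cong)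
  show span: "coord_space I = span ?B"
  proof
    show "coord_space I \<subseteq> span ?B"
    proof
      fix y :: "'a rvec" assume "y \<in> coord_space I"
      then have "y = (\<Sum>k\<in>I. Poly_Mapping.lookup y k *\<^sub>R Poly_Mapping.single k 1)"
        by (intro poly_mapping_eqI) (auto simp: lookup coord_space_iff)
      also have "\<dots> \<in> span ?B"
        by (intro span_sum span_scale span_base) auto
      finally show "y \<in> span ?B" .
    qed
    show "span ?B \<subseteq> coord_space I"
      by (intro span_minimal subspace_coord_space) (auto simp: coord_space_iff lookup_single when_def)
  qed
  show indep: "independent ?B"
  proof (rule real_vector.independent_if_scalars_zero)
    fix f :: "'a rvec \<Rightarrow> real" and x assume "(\<Sum>x\<in>?B. f x *\<^sub>R x) = 0" and "x \<in> ?B"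
    then obtain j where j: "j \<in> I" "x = Poly_Mapping.single j 1"
      and 0: "(\<Sum>k\<in>I. f (Poly_Mapping.single k 1) *\<^sub>R Poly_Mapping.single k 1) = (0 :: 'a rvec)"
      by (auto simp: sum.reindex[OF inj])
    show "f x = 0"
      using arg_cong[OF 0, of "\<lambda>y. Poly_Mapping.lookup y j"] j by (simp only: lookup) simp
  qed (use assms in simp)
  show "dim (coord_space I) = card I"
    unfolding span using indep by (simp add: real_vector.dim_eq_card_independent card_image[OF inj])
qed

section \<open>The codimension bound\<close>

lemma uniquely_identifiable_codim_le:
  fixes S :: "'i rvec set"
  assumes I: "finite I" and S: "subspace S" "S \<subseteq> coord_space I"
    and v: "\<And>i. i \<in> {1..n} \<Longrightarrow> ones (v i) \<subseteq> I"
    and unique: "uniquely_identifiable I S n v"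
  shows "int (card I) - int (dim S) \<le>
    (\<Sum>i = 1..n. int (card (ones (v i))) - int (dim (canonical_projection (v i) S)))"
proof -
  let ?P = "\<lambda>i. canonical_projection (v i) S"
  \<comment> \<open>Bundling these properties lets a single choice produce a family \<open>J\<close>
    of equation sets, one for each pattern.\<close>
  define cuts_out where "cuts_out i J \<longleftrightarrow> finite J \<and> card J + dim (?P i) = card (ones (v i)) \<and>
      (\<forall>g\<in>J. linear g) \<and> ?P i = {y \<in> coord_space (ones (v i)). \<forall>g\<in>J. g y = 0}"
    for i and J :: "('i rvec \<Rightarrow> real) set"
  have "\<exists>J. cuts_out i J" if i: "i \<in> {1..n}" for i
  proof -
    have fin: "finite (ones (v i))"
      using v[OF i] I finite_subset by blast
    have "subspace (?P i)" (is ?sub)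
      unfolding canonical_projection_def by (intro linear_subspace_image linear_restriction S)
    have "?P i \<subseteq> coord_space (ones (v i))" (is ?le)
      by (auto simp: canonical_projection_def coord_space_iff lookup_restriction)
    show ?thesis
    proof (rule subspace_eq_common_kernel[OF \<open>?sub\<close> subspace_coord_space \<open>?le\<close> finite_imageI[OF fin]
          equalityD1[OF coord_space_basis(1)[OF fin]]])
      fix J :: "('i rvec \<Rightarrow> real) set"
      assume "finite J" "card J + dim (?P i) = dim (coord_space (ones (v i)))"
        "\<forall>g\<in>J. linear g" "?P i = {y \<in> coord_space (ones (v i)). \<forall>g\<in>J. g y = 0}"
      then show ?thesis
        unfolding coord_space_basis(3)[OF fin] cuts_out_def by (intro exI[of _ J] conjI)
    qed
  qed
  then obtain J where cuts_out: "\<And>i. i \<in> {1..n} \<Longrightarrow> cuts_out i (J i)"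
    by metis
  have J: "finite (J i)" "card (J i) + dim (?P i) = card (ones (v i))" "\<forall>g\<in>J i. linear g"
    "?P i = {y \<in> coord_space (ones (v i)). \<forall>g\<in>J i. g y = 0}" if "i \<in> {1..n}" for i
    using cuts_out[OF that] unfolding cuts_out_def by blast+
  \<comment> \<open>Equations for the projections are pulled back to the full space. Indexing by
    pairs makes the count the sum of the \<open>card (J i)\<close>, even if pullbacks from different
    patterns agree.\<close>
  define G where "G = (\<lambda>(i, g :: 'i rvec \<Rightarrow> real). g \<circ> restriction (v i))"
  define T where "T = {y \<in> coord_space I. \<forall>j\<in>Sigma {1..n} J. G j y = 0}"
  have G: "linear (G j)" if "j \<in> Sigma {1..n} J" for j
    using that J(3) by (auto simp: G_def intro!: linear_compose linear_restriction)
  \<comment> \<open>A restriction always lies in \<open>coord_space (ones (v i))\<close>, so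
    satisfying the equations in \<open>J i\<close> is the same as lying in the projection of
    \<open>S\<close>.\<close>
  have T_iff: "y \<in> T \<longleftrightarrow> y \<in> coord_space I \<and> (\<forall>i\<in>{1..n}. restriction (v i) y \<in> ?P i)" for y
    using J(4) by (auto simp: T_def G_def coord_space_iff lookup_restriction)
  have "subspace T"
    using subspace_coord_space G unfolding T_def
    by (auto simp: subspace_def linear_0 linear_add linear_scale)
  moreover have "S \<subseteq> T"
    using S(2) by (auto simp: T_iff canonical_projection_def)
  \<comment> \<open>One inclusion is the definition of \<open>T\<close>, the other follows from
    \<open>S \<subseteq> T\<close>.\<close>
  then have "canonical_projection (v i) T = ?P i" if "i \<in> {1..n}" for i
    using that by (auto simp: T_iff canonical_projection_def)
  ultimately have "T = S"
    using unique by (auto simp: uniquely_identifiable_def T_iff)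
  have "card I \<le> dim T + card (Sigma {1..n} J)"
    unfolding T_def coord_space_basis(3)[OF I, symmetric]
    by (rule dim_le_dim_common_kernel[where F = "(\<lambda>k. Poly_Mapping.single k 1) ` I"])
      (use I J(1) G subspace_coord_space coord_space_basis(1)[OF I] in auto)
  also have "card (Sigma {1..n} J) = (\<Sum>i = 1..n. card (J i))"
    using J(1) by (intro card_SigmaI) auto
  finally have le: "card I \<le> dim S + (\<Sum>i = 1..n. card (J i))"
    unfolding \<open>T = S\<close> .
  have "(\<Sum>i = 1..n. int (card (ones (v i))) - int (dim (?P i))) = int (\<Sum>i = 1..n. card (J i))"
    unfolding of_nat_sum using J(2) by (intro sum.cong) force+
  with le show ?thesis
    by linarith
qed

section \<open>Tensor indices and the final inequality\<close>

text \<open>Sorted lists are canonical forms of multisets, so this is the count of multisets of size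
  \<open>p\<close> over \<open>d\<close> elements.\<close>

lemma card_tensor_index: "card (tensor_index d p) = (d + p - 1) choose p"
proof -
  have len: "length (sorted_list_of_multiset X) = size X" for X :: "nat multiset"
    by (metis mset_sorted_list_of_multiset size_mset)
  have "bij_betw mset (tensor_index d p) (multisets_of_size {1..d} p)"
    by (rule bij_betw_byWitness[where f' = sorted_list_of_multiset])
      (auto simp: tensor_index_def multisets_of_size_def sorted_sort_id len)
  then show ?thesis
    using card_multisets_of_size[of "{1..d}" p] by (simp add: bij_betw_same_card)
qed

lemma tensor_power_in_tensor_space: "tensor_power d p x \<in> tensor_space d p"
  by (simp add: coord_space_iff lookup_tensor_power)

theorem lemma3:
  fixes d p D R n :: nat
    and V :: "nat rvec set"
    and S :: "nat list rvec set"
    and v :: "nat \<Rightarrow> nat list rvec"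
    and M R' :: "nat \<Rightarrow> nat"
  assumes "d \<ge> 1" and "p \<ge> 1"
    and "D = (d + p - 1) choose p"
    and "projective_variety d V"
    and "S = tensorized_subspace d p V"
    and "dim S = R"
    and "\<And>i. i \<in> {1..n} \<Longrightarrow> v i \<in> tensorized_patterns d p"
    and "inj_on v {1..n}"
    and "\<And>i. i \<in> {1..n} \<Longrightarrow> M i = card (ones (v i))"
    and "\<And>i. i \<in> {1..n} \<Longrightarrow> R' i = dim (canonical_projection (v i) S)"
    and "uniquely_identifiable (tensor_index d p) S n v"
  shows "(\<Sum>i = 1..n. int (M i) - int (R' i)) \<ge> int D - int R"
proof -
  have "S \<subseteq> tensor_space d p"
    unfolding assms(5) tensorized_subspace_def
    by (intro span_minimal subspace_coord_space) (auto simp: tensor_power_in_tensor_space)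
  moreover have "subspace S"
    by (simp add: assms(5) tensorized_subspace_def)
  \<comment> \<open>A pattern is itself a tensor power, whose coordinates off
    \<open>tensor_index d p\<close> are 0 and hence not 1.\<close>
  moreover have "ones (v i) \<subseteq> tensor_index d p" if "i \<in> {1..n}" for i
    using assms(7)[OF that]
    by (auto simp: tensorized_patterns_def ones_def lookup_tensor_power split: if_splits)
  ultimately have "int (card (tensor_index d p)) - int (dim S) \<le>
      (\<Sum>i = 1..n. int (card (ones (v i))) - int (dim (canonical_projection (v i) S)))"
    using assms(11) by (intro uniquely_identifiable_codim_le finite_tensor_index)
  then show ?thesis
    using assms(3,6,9,10) by (simp add: card_tensor_index)
qed

end
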